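(* Let $r>0$, $H>0$ and consider the restricted two-dimensional Newton problem of minimal resistance $$R[u(\cdot)]=\int_0^r\frac{1}{1+u(x)^2}\,dx\longrightarrow\min,\qquad \dot y(x)=u(x),\quad u(x)\ge 0,\quad y(0)=0,\quad y(r)=H.$$ This problem always admits a solution (a global minimizer): (1) when $H>r$, there is a unique solution, associated to the control $u(x)=\frac{H}{r}$ for all $x\in[0,r]$; (2) when $H\le r$, there are infinitely many solutions, associated to the controls $$u_n(x)=\begin{cases}0 & \text{if } \xi_{2i}\le x\le\xi_{2i+1},\quad i=0,\ldots,n,\\ 1 & \text{if } \xi_{2i+1}\le x\le \xi_{2i+2},\quad i=0,\ldots,n-1,\end{cases}$$ where $n\in\{1,2,\ldots\}$, $0=\xi_0\le\xi_1\le\cdots\le\xi_{2n+1}=r$ and $\sum_{i=1}^{n}(\xi_{2i}-\xi_{2i-1})=H$. In the case $H>r$ the minimum value of the resistance $R$ is $\frac{r^3}{r^2+H^2}$; otherwise (when $H\le r$) it is $r-\frac{H}{2}$.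
   Context: Admissible pairs $(y(\cdot),u(\cdot))$: $y:[0,r]\to\mathbb{R}$ is continuous with piecewise continuous derivative, $u=\dot y$ is piecewise continuous on $[0,r]$ with values in $\mathbb{R}_0^+=[0,+\infty)$, and $y(0)=0$, $y(r)=H$. A solution is an admissible $y(\cdot)$ whose control $u=\dot y$ satisfies $R[u(\cdot)]\le R[v(\cdot)]$ for the control $v(\cdot)$ of every admissible pair. The solution associated to a control $u(\cdot)$ is $y(x)=\int_0^x u(t)\,dt$. Controls are identified when they differ only at finitely many points; in particular the values at the switching points $\xi_j$ are immaterial.
   Formalization: That there are infinitely many solutions is asserted only for H < r, since for H = r every u_n equals 1 off finitely many points and y(x) = x is the only solution; the description of the solutions by the u_n and the minimum r − H/2 are kept for all H ≤ r. *)

theory Defs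
  imports "HOL-Analysis.Analysis"
begin

definition piecewise_continuous :: "real \<Rightarrow> real \<Rightarrow> (real \<Rightarrow> real) \<Rightarrow> bool" where
  "piecewise_continuous a b u \<longleftrightarrow>
     (\<exists>S. finite S \<and> continuous_on ({a..b} - S) u) \<and>
     (\<forall>x\<in>{a..<b}. \<exists>l. (u \<longlongrightarrow> l) (at_right x)) \<and>
     (\<forall>x\<in>{a<..b}. \<exists>l. (u \<longlongrightarrow> l) (at_left x))"

(* A function y on [0,r] is an element of extensional {0..r}, so that equality of HOL functions is
   equality on [0,r] and solutions can be counted.  Controls are only relevant up to finitely many
   points; hence y' = u is required off a finite set. *)
definition admissible :: "real \<Rightarrow> real \<Rightarrow> (real \<Rightarrow> real) \<Rightarrow> (real \<Rightarrow> real) \<Rightarrow> bool" where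
  "admissible r H y u \<longleftrightarrow>
     y \<in> extensional {0..r} \<and> continuous_on {0..r} y \<and>
     piecewise_continuous 0 r u \<and> (\<forall>x\<in>{0..r}. 0 \<le> u x) \<and>
     (\<exists>S. finite S \<and> (\<forall>x\<in>{0..r} - S. (y has_real_derivative u x) (at x within {0..r}))) \<and>
     y 0 = 0 \<and> y r = H"

definition resistance :: "real \<Rightarrow> (real \<Rightarrow> real) \<Rightarrow> real" where
  "resistance r u = integral {0..r} (\<lambda>x. 1 / (1 + (u x)\<^sup>2))"

definition newton_solutions :: "real \<Rightarrow> real \<Rightarrow> (real \<Rightarrow> real) set" where
  "newton_solutions r H =
     {y. \<exists>u. admissible r H y u \<and>
             (\<forall>z v. admissible r H z v \<longrightarrow> resistance r u \<le> resistance r v)}"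

definition is_min_resistance :: "real \<Rightarrow> real \<Rightarrow> real \<Rightarrow> bool" where
  "is_min_resistance r H m \<longleftrightarrow>
     (\<exists>y u. admissible r H y u \<and> resistance r u = m) \<and>
     (\<forall>y u. admissible r H y u \<longrightarrow> m \<le> resistance r u)"

definition associated_solution :: "real \<Rightarrow> (real \<Rightarrow> real) \<Rightarrow> real \<Rightarrow> real" where
  "associated_solution r u = (\<lambda>x\<in>{0..r}. integral {0..x} u)"

definition switching_points :: "real \<Rightarrow> real \<Rightarrow> nat \<Rightarrow> (nat \<Rightarrow> real) \<Rightarrow> bool" where
  "switching_points r H n \<xi> \<longleftrightarrow>
     1 \<le> n \<and> \<xi> 0 = 0 \<and> \<xi> (2 * n + 1) = r \<and> (\<forall>i\<le>2 * n. \<xi> i \<le> \<xi> (Suc i)) \<and>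
     (\<Sum>i = 1..n. \<xi> (2 * i) - \<xi> (2 * i - 1)) = H"

(* At the switching points both of the first two cases apply, and the value 0 is chosen;
   the last case only concerns arguments outside [0,r]. *)
definition switching_control :: "nat \<Rightarrow> (nat \<Rightarrow> real) \<Rightarrow> real \<Rightarrow> real" where
  "switching_control n \<xi> x =
     (if \<exists>i\<in>{0..n}. \<xi> (2 * i) \<le> x \<and> x \<le> \<xi> (2 * i + 1) then 0
      else if \<exists>i\<in>{0..<n}. \<xi> (2 * i + 1) \<le> x \<and> x \<le> \<xi> (2 * i + 2) then 1
      else 0)"

end

theory Submission
  imports Defs
begin

text \<open>
  The constraint fixes the integral of \<open>u\<close>, namely \<open>H\<close>, while the functional integrates
  \<open>1 / (1 + u\<^sup>2)\<close>.  Hence an affine function \<open>c0 + c1 * s\<close> that stays below \<open>1 / (1 + s\<^sup>2)\<close>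
  for all \<open>s \<ge> 0\<close> has the same integral \<open>c0 * r + c1 * H\<close> along every admissible control, and
  this number is a lower bound for the resistance.  The bound is attained exactly by the controls
  that take values in the contact set of the line, up to finitely many points.  So everything
  depends on a good choice of the line (\<open>minimizers_from_support\<close>).

  The density \<open>1 / (1 + s\<^sup>2)\<close> is not convex on \<open>[0, \<infinity>)\<close>.  The largest convex function below it
  is the chord \<open>1 - s / 2\<close> from \<open>s = 0\<close> to \<open>s = 1\<close>, which is tangent at \<open>1\<close>, followed by the
  density itself.  The mean slope \<open>H / r\<close> decides which part matters.  If \<open>H > r\<close>, the tangent
  at \<open>a = H / r > 1\<close> lies below the density and touches it only at \<open>a\<close>, so the straight line is
  the only minimizer (\<open>minimizers_steep\<close>).  If \<open>H \<le> r\<close>, the chord touches at \<open>0\<close> and \<open>1\<close>, so the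
  minimizers are the solutions whose slope is \<open>0\<close> or \<open>1\<close> off a finite set
  (\<open>minimizers_flat\<close>).

  To bring such a solution into the form of a switching control, note that a control continuous
  off a finite set with values in \<open>{0, 1}\<close> is constant between consecutive exceptional points.
  Each of these intervals is read as a stretch of zeros followed by a stretch of ones, one of the
  two being degenerate (\<open>zero_one_control_switching\<close>).
\<close>

section \<open>Admissible pairs and their integrals\<close>

lemma admissible_has_integral:
  assumes "admissible r H y u" "x \<in> {0..r}"
  shows "(u has_integral y x) {0..x}"
proof -
  obtain S where S: "finite S"
    "\<And>t. t \<in> {0..r} - S \<Longrightarrow> (y has_real_derivative u t) (at t within {0..r})"
    using assms unfolding admissible_def by blast
  have "(u has_integral (y x - y 0)) {0..x}"
  proof (rule fundamental_theorem_of_calculus_interior_strong[OF S(1)])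
    show "0 \<le> x" using assms by auto
    show "continuous_on {0..x} y"
      using assms unfolding admissible_def by (auto intro: continuous_on_subset)
    fix t assume t: "t \<in> {0<..<x} - S"
    then have "(y has_real_derivative u t) (at t within {0..r})"
      using S(2) assms(2) by auto
    moreover have "at t within {0..r} = at t"
      using t assms(2) by (intro at_within_interior) auto
    ultimately show "(y has_vector_derivative u t) (at t)"
      by (simp add: has_real_derivative_iff_has_vector_derivative)
  qed
  then show ?thesis using assms unfolding admissible_def by simp
qed

lemma admissible_eq_associated:
  assumes "admissible r H y u"
  shows "y = associated_solution r u"
proof
  fix x show "y x = associated_solution r u x"
  proof (cases "x \<in> {0..r}")
    case True
    then show ?thesis
      using admissible_has_integral[OF assms True]
      by (simp add: associated_solution_def integral_unique)
  next
    case False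
    then show ?thesis
      using assms by (auto simp: admissible_def associated_solution_def extensional_def)
  qed
qed

lemma associated_solution_cong:
  assumes "finite S" "\<And>x. x \<in> {0..r} - S \<Longrightarrow> u x = v x"
  shows "associated_solution r u = associated_solution r v"
  unfolding associated_solution_def
proof (rule restrict_ext)
  fix x assume "x \<in> {0..r}"
  then show "integral {0..x} u = integral {0..x} v"
    using assms by (intro integral_spike[of S]) auto
qed

text \<open>The derivative of the indefinite integral exists wherever \<open>u\<close> is continuous; the points
  where it is not are absorbed by the finite exceptional set in the notion of admissibility.\<close>
lemma admissible_associated:
  assumes "0 \<le> r" and pc: "piecewise_continuous 0 r u"
    and nonneg: "\<And>x. x \<in> {0..r} \<Longrightarrow> 0 \<le> u x"
    and int: "(u has_integral H) {0..r}"
  shows "admissible r H (associated_solution r u) u"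
proof -
  obtain S where S: "finite S" "continuous_on ({0..r} - S) u"
    using pc unfolding piecewise_continuous_def by blast
  have uint: "u integrable_on {0..r}" using int by auto
  have "(associated_solution r u has_real_derivative u x) (at x within {0..r})"
    if x: "x \<in> {0..r} - S" for x
  proof -
    have "((\<lambda>t. integral {0..t} u) has_vector_derivative u x) (at x within ({0..r} - S))"
      using S x by (intro integral_has_vector_derivative_continuous_at[OF uint])
        (auto simp: continuous_on_eq_continuous_within)
    moreover have "at x within ({0..r} - S) = at x within {0..r}"
      using x S(1) by (intro at_within_nhd[of _ "- S"]) (auto intro: finite_imp_closed)
    ultimately have "((\<lambda>t. integral {0..t} u) has_real_derivative u x) (at x within {0..r})"
      by (simp add: has_real_derivative_iff_has_vector_derivative)
    then show ?thesis
      using x by (elim has_field_derivative_transform_within[where d = 1])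
        (auto simp: associated_solution_def)
  qed
  moreover have "continuous_on {0..r} (associated_solution r u)"
    using indefinite_integral_continuous_1[OF uint]
    by (rule continuous_on_eq) (simp add: associated_solution_def)
  moreover have "associated_solution r u \<in> extensional {0..r}"
    by (simp add: associated_solution_def)
  moreover have "associated_solution r u 0 = 0" "associated_solution r u r = H"
    using int \<open>0 \<le> r\<close> by (auto simp: associated_solution_def integral_unique)
  ultimately show ?thesis
    unfolding admissible_def using pc nonneg S(1) by blast
qed

section \<open>Supporting lines of the resistance density\<close>

lemma bounded_continuous_off_finite_integrable:
  fixes f :: "real \<Rightarrow> real"
  assumes "finite S" "continuous_on ({a..b} - S) f"
    and bound: "\<And>x. x \<in> {a..b} \<Longrightarrow> \<bar>f x\<bar> \<le> B"
  shows "f integrable_on {a..b}"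
proof -
  have meas: "{a..b} - S \<in> sets lebesgue"
    using assms(1) by (intro sets.Diff) (auto intro: negligible_imp_sets)
  have "f integrable_on ({a..b} - S)"
  proof (rule measurable_bounded_by_integrable_imp_integrable)
    show "f \<in> borel_measurable (lebesgue_on ({a..b} - S))"
      using assms(2) meas by (rule continuous_imp_measurable_on_sets_lebesgue)
    show "(\<lambda>_. B) integrable_on ({a..b} - S)"
      by (rule integrable_spike_set[of _ "{a..b}"])
        (auto intro!: negligible_subset[OF negligible_finite[OF assms(1)]])
    show "norm (f x) \<le> B" if "x \<in> {a..b} - S" for x using bound that by auto
    show "{a..b} - S \<in> sets lebesgue" by (fact meas)
  qed
  then show ?thesis
    by (rule integrable_spike_set)
      (auto intro!: negligible_subset[OF negligible_finite[OF assms(1)]])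
qed

text \<open>Near a point of continuity off the finite set the function is continuous on a whole interval,
  where its integral must vanish too; a continuous nonnegative function with zero integral is zero.\<close>
lemma nonneg_integral_zero_off_finite:
  fixes g :: "real \<Rightarrow> real"
  assumes "finite S" "continuous_on ({a..b} - S) g"
    and nonneg: "\<And>x. x \<in> {a..b} \<Longrightarrow> 0 \<le> g x"
    and int: "(g has_integral 0) {a..b}"
    and x: "x \<in> {a<..<b} - S"
  shows "g x = 0"
proof -
  have "open ({a<..<b} - S)" using assms(1) by (simp add: finite_imp_closed open_Diff)
  then obtain e where e: "e > 0" "cball x e \<subseteq> {a<..<b} - S"
    using x by (meson open_contains_cball)
  define c d where "c = x - e" and "d = x + e"
  have sub: "{c..d} \<subseteq> {a<..<b} - S"
    using e(2) by (simp add: c_def d_def cball_eq_atLeastAtMost)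
  have gint: "g integrable_on {a..b}" using int by auto
  have ab: "{c..d} \<subseteq> {a..b}"
    using order_trans[OF sub, of "{a..b}"] by fastforce
  have gcd: "g integrable_on {c..d}"
    using integrable_on_subinterval[OF gint ab] .
  have "integral {c..d} g \<le> integral {a..b} g"
    using ab gcd gint nonneg by (intro integral_subset_le) auto
  moreover have "0 \<le> integral {c..d} g"
    using ab nonneg by (intro integral_nonneg[OF gcd]) auto
  ultimately have "(g has_integral 0) (cbox c d)"
    using int gcd by (simp add: has_integral_iff)
  moreover have "continuous_on (cbox c d) g"
  proof -
    have "{c..d} \<subseteq> {a..b} - S" using sub ab by blast
    then show ?thesis using continuous_on_subset[OF assms(2)] by simp
  qed
  moreover have "0 \<le> g t" if "t \<in> box c d" for t
  proof -
    have "t \<in> {c..d}" using that by simp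
    then show ?thesis using ab nonneg by blast
  qed
  moreover have "x \<in> cbox c d" "box c d \<noteq> {}" using e(1) by (simp_all add: c_def d_def)
  ultimately show ?thesis
    using has_integral_0_cbox_imp_0[of c d g x] by blast
qed

definition resistance_support :: "real \<Rightarrow> real \<Rightarrow> bool" where
  "resistance_support c0 c1 \<longleftrightarrow> (\<forall>s\<ge>0. c0 + c1 * s \<le> 1 / (1 + s\<^sup>2))"

text \<open>The integral of \<open>u\<close> is \<open>H\<close> for every admissible control, so the affine part contributes a
  constant.\<close>
lemma resistance_excess:
  assumes "admissible r H y u" "0 \<le> r"
  shows "((\<lambda>x. 1 / (1 + (u x)\<^sup>2) - (c0 + c1 * u x))
           has_integral (resistance r u - (c0 * r + c1 * H))) {0..r}"
proof -
  obtain S where S: "finite S" "continuous_on ({0..r} - S) u"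
    using assms unfolding admissible_def piecewise_continuous_def by blast
  have ge1: "1 \<le> 1 + (u x)\<^sup>2" for x by simp
  have "(\<lambda>x. 1 / (1 + (u x)\<^sup>2)) integrable_on {0..r}"
  proof (rule bounded_continuous_off_finite_integrable[OF S(1), where B = 1])
    have "1 + (u x)\<^sup>2 \<noteq> 0" for x using ge1[of x] by linarith
    then show "continuous_on ({0..r} - S) (\<lambda>x. 1 / (1 + (u x)\<^sup>2))"
      using S(2) by (intro continuous_intros) auto
    show "\<bar>1 / (1 + (u x)\<^sup>2)\<bar> \<le> 1" for x
    proof -
      have "1 + (u x)\<^sup>2 > 0" using ge1[of x] by linarith
      then show ?thesis by (simp add: divide_le_eq_1)
    qed
  qed
  then have "((\<lambda>x. 1 / (1 + (u x)\<^sup>2)) has_integral resistance r u) {0..r}"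
    by (simp add: resistance_def has_integral_integral)
  moreover have "((\<lambda>x. c1 * u x) has_integral (c1 * H)) {0..r}"
    using admissible_has_integral[OF assms(1), of r] assms
    by (intro has_integral_mult_right) (simp add: admissible_def)
  moreover have "((\<lambda>_. c0) has_integral (c0 * r)) {0..r}"
    using has_integral_const_real[of c0 0 r] assms(2) by (simp add: mult.commute)
  ultimately show ?thesis
    by (intro has_integral_diff has_integral_add)
qed

lemma resistance_excess_nonneg:
  assumes "resistance_support c0 c1" "admissible r H y u" "x \<in> {0..r}"
  shows "0 \<le> 1 / (1 + (u x)\<^sup>2) - (c0 + c1 * u x)"
proof -
  have "0 \<le> u x" using assms(2,3) unfolding admissible_def by blast
  then show ?thesis using assms(1) by (simp add: resistance_support_def)
qed

lemma resistance_ge_support: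
  assumes "resistance_support c0 c1" "admissible r H y u" "0 \<le> r"
  shows "c0 * r + c1 * H \<le> resistance r u"
proof -
  have "0 \<le> resistance r u - (c0 * r + c1 * H)"
    using resistance_excess[OF assms(2,3)] resistance_excess_nonneg[OF assms(1,2)]
    by (rule has_integral_nonneg)
  then show ?thesis by simp
qed

lemma resistance_eq_support_iff:
  assumes "resistance_support c0 c1" "admissible r H y u" "0 \<le> r"
  shows "resistance r u = c0 * r + c1 * H \<longleftrightarrow>
    (\<exists>S. finite S \<and> (\<forall>x\<in>{0..r} - S. 1 / (1 + (u x)\<^sup>2) = c0 + c1 * u x))"
    (is "_ \<longleftrightarrow> ?contact")
proof
  let ?g = "\<lambda>x. 1 / (1 + (u x)\<^sup>2) - (c0 + c1 * u x)"
  assume eq: "resistance r u = c0 * r + c1 * H"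
  obtain S where S: "finite S" "continuous_on ({0..r} - S) u"
    using assms unfolding admissible_def piecewise_continuous_def by blast
  have ne: "1 + (u x)\<^sup>2 \<noteq> 0" for x
    using zero_le_power2[of "u x"] by linarith
  have zero: "?g x = 0" if "x \<in> {0<..<r} - S" for x
  proof (rule nonneg_integral_zero_off_finite[OF S(1) _ _ _ that])
    show "continuous_on ({0..r} - S) ?g" using ne S(2) by (intro continuous_intros) auto
    show "0 \<le> ?g x" if "x \<in> {0..r}" for x
      using resistance_excess_nonneg[OF assms(1,2) that] .
    show "(?g has_integral 0) {0..r}"
      using resistance_excess[OF assms(2,3), of c0 c1] eq by simp
  qed
  have "1 / (1 + (u x)\<^sup>2) = c0 + c1 * u x" if "x \<in> {0..r} - (S \<union> {0, r})" for x
    using zero[of x] that by auto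
  then show ?contact using S(1) by (intro exI[of _ "S \<union> {0, r}"]) blast
next
  assume ?contact
  then obtain S where S: "finite S" "\<forall>x\<in>{0..r} - S. 1 / (1 + (u x)\<^sup>2) = c0 + c1 * u x"
    by blast
  have "((\<lambda>x. 1 / (1 + (u x)\<^sup>2) - (c0 + c1 * u x)) has_integral 0) {0..r}"
    using S(2) by (intro has_integral_spike_finite[OF S(1) _ has_integral_0]) simp
  from has_integral_unique[OF resistance_excess[OF assms(2,3), of c0 c1] this]
  show "resistance r u = c0 * r + c1 * H" by simp
qed

text \<open>One admissible control inside the contact set \<open>C\<close> attains the lower bound given by the
  supporting line.  Being optimal then means attaining it, hence staying in \<open>C\<close> off a finite set.\<close>
lemma minimizers_from_support:
  assumes "0 \<le> r" and supp: "resistance_support c0 c1"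
    and touch: "\<And>s. s \<ge> 0 \<Longrightarrow> 1 / (1 + s\<^sup>2) = c0 + c1 * s \<longleftrightarrow> s \<in> C"
    and wit: "admissible r H y0 u0" "\<And>x. x \<in> {0..r} \<Longrightarrow> u0 x \<in> C"
  shows "is_min_resistance r H (c0 * r + c1 * H)"
    and "newton_solutions r H =
      {y. \<exists>u. admissible r H y u \<and> (\<exists>S. finite S \<and> (\<forall>x\<in>{0..r} - S. u x \<in> C))}"
proof -
  have attained_iff: "resistance r u = c0 * r + c1 * H \<longleftrightarrow>
    (\<exists>S. finite S \<and> (\<forall>x\<in>{0..r} - S. u x \<in> C))" if "admissible r H y u" for y u
  proof -
    have "\<And>x. x \<in> {0..r} \<Longrightarrow> 0 \<le> u x" using that unfolding admissible_def by blast
    then have "(\<forall>x\<in>{0..r} - S. 1 / (1 + (u x)\<^sup>2) = c0 + c1 * u x) \<longleftrightarrow>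
        (\<forall>x\<in>{0..r} - S. u x \<in> C)" for S
      using touch by (intro ball_cong) auto
    then show ?thesis
      unfolding resistance_eq_support_iff[OF supp that \<open>0 \<le> r\<close>] by simp
  qed
  have attained: "resistance r u0 = c0 * r + c1 * H"
    unfolding attained_iff[OF wit(1)] using wit(2) by (intro exI[of _ "{}"]) simp
  have bound: "c0 * r + c1 * H \<le> resistance r v" if "admissible r H z v" for z v
    by (rule resistance_ge_support[OF supp that \<open>0 \<le> r\<close>])
  show "is_min_resistance r H (c0 * r + c1 * H)"
    unfolding is_min_resistance_def using wit(1) attained bound by blast
  have optimal_iff: "(\<forall>z v. admissible r H z v \<longrightarrow> resistance r u \<le> resistance r v) \<longleftrightarrow>
    resistance r u = c0 * r + c1 * H" (is "?opt \<longleftrightarrow> _") if "admissible r H y u" for y u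
  proof
    assume ?opt
    then have "resistance r u \<le> resistance r u0" using wit(1) by blast
    then show "resistance r u = c0 * r + c1 * H" using attained bound[OF that] by simp
  next
    assume "resistance r u = c0 * r + c1 * H"
    then show ?opt using bound by simp
  qed
  show "newton_solutions r H =
      {y. \<exists>u. admissible r H y u \<and> (\<exists>S. finite S \<and> (\<forall>x\<in>{0..r} - S. u x \<in> C))}"
    unfolding newton_solutions_def
    by (intro Collect_cong ex_cong1 conj_cong refl) (simp only: optimal_iff attained_iff)
qed

text \<open>The gap between the density and its tangent at \<open>a\<close> is a square times a factor that is positive
  for all \<open>s \<ge> 0\<close> when \<open>a > 1\<close>.  For \<open>a = 1\<close> the factor becomes \<open>2 * s\<close>, which is where the second
  contact point \<open>0\<close> comes from.\<close>
lemma resistance_tangent_identity: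
  fixes a s :: real
  shows "1 / (1 + s\<^sup>2) - (1 / (1 + a\<^sup>2) - 2 * a / (1 + a\<^sup>2)\<^sup>2 * (s - a))
    = (s - a)\<^sup>2 * (2 * a * s + a\<^sup>2 - 1) / ((1 + s\<^sup>2) * (1 + a\<^sup>2)\<^sup>2)"
proof -
  have "1 + s\<^sup>2 \<noteq> 0" "1 + a\<^sup>2 \<noteq> 0"
    using zero_le_power2[of s] zero_le_power2[of a] by linarith+
  then show ?thesis
    by (simp add: divide_simps) (simp add: power2_eq_square algebra_simps)
qed

section \<open>Step functions\<close>

lemma breakpoints_mono:
  fixes p :: "nat \<Rightarrow> real"
  assumes mono: "\<And>j. j < N \<Longrightarrow> p j \<le> p (Suc j)" and "i \<le> j" "j \<le> N"
  shows "p i \<le> p j"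
  using \<open>i \<le> j\<close> \<open>j \<le> N\<close>
proof (induction j rule: dec_induct)
  case (step j)
  then show ?case using mono[of j] by simp
qed simp

lemma cell_right:
  fixes p :: "nat \<Rightarrow> real"
  assumes "p 0 \<le> x" "x < p N"
  shows "\<exists>j<N. p j \<le> x \<and> x < p (Suc j)"
  using assms
proof (induction N)
  case (Suc N)
  then show ?case by (cases "x < p N") (auto intro: less_SucI)
qed simp

lemma cell_left:
  fixes p :: "nat \<Rightarrow> real"
  assumes "p 0 < x" "x \<le> p N"
  shows "\<exists>j<N. p j < x \<and> x \<le> p (Suc j)"
  using assms
proof (induction N)
  case (Suc N)
  then show ?case by (cases "x \<le> p N") (auto intro: less_SucI)
qed simp

lemma cell_interior:
  fixes p :: "nat \<Rightarrow> real"
  assumes "x \<in> {p 0..p N} - p ` {..N}"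
  shows "\<exists>j<N. p j < x \<and> x < p (Suc j)"
proof -
  have "x < p N" using assms by (metis DiffE atLeastAtMost_iff atMost_iff imageI order_le_less order_refl)
  then obtain j where "j < N" "p j \<le> x" "x < p (Suc j)"
    using cell_right[of p x N] assms by auto
  moreover have "p j \<noteq> x" using assms \<open>j < N\<close> by auto
  ultimately show ?thesis by force
qed

lemma step_function_has_integral:
  fixes p :: "nat \<Rightarrow> real" and f :: "real \<Rightarrow> real"
  assumes mono: "\<And>j. j < N \<Longrightarrow> p j \<le> p (Suc j)"
    and const: "\<And>j x. j < N \<Longrightarrow> p j < x \<Longrightarrow> x < p (Suc j) \<Longrightarrow> f x = c j"
  shows "(f has_integral (\<Sum>j<N. c j * (p (Suc j) - p j))) {p 0..p N}"
  using assms
proof (induction N)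
  case (Suc N)
  have "((\<lambda>_. c N) has_integral (c N * (p (Suc N) - p N))) {p N..p (Suc N)}"
    using has_integral_const_real[of "c N" "p N" "p (Suc N)"] Suc.prems(1)[of N]
    by (simp add: mult.commute)
  then have "(f has_integral (c N * (p (Suc N) - p N))) {p N..p (Suc N)}"
    using Suc.prems(2)[of N]
    by (intro has_integral_spike_finite[of "{p N, p (Suc N)}" _ f "\<lambda>_. c N"]) auto
  moreover have "p 0 \<le> p N" by (rule breakpoints_mono[of N]) (auto intro: Suc.prems)
  moreover have "p N \<le> p (Suc N)" by (simp add: Suc.prems)
  moreover have "(f has_integral (\<Sum>j<N. c j * (p (Suc j) - p j))) {p 0..p N}"
    by (rule Suc.IH) (simp_all add: Suc.prems)
  ultimately show ?case
    using has_integral_combine[of "p 0" "p N" "p (Suc N)" f] by simp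
next
  case 0
  then show ?case using has_integral_refl(1)[of f "p 0"] by simp
qed

lemma step_function_piecewise_continuous:
  fixes p :: "nat \<Rightarrow> real" and f :: "real \<Rightarrow> real"
  assumes const: "\<And>j x. j < N \<Longrightarrow> p j < x \<Longrightarrow> x < p (Suc j) \<Longrightarrow> f x = c j"
  shows "piecewise_continuous (p 0) (p N) f"
  unfolding piecewise_continuous_def
proof (intro conjI exI[of _ "p ` {..N}"] ballI)
  show "finite (p ` {..N})" by simp
  show "continuous_on ({p 0..p N} - p ` {..N}) f"
  proof (intro continuous_at_imp_continuous_on ballI)
    fix x assume "x \<in> {p 0..p N} - p ` {..N}"
    then obtain j where j: "j < N" "p j < x" "x < p (Suc j)"
      using cell_interior by blast
    have "continuous_on {p j<..<p (Suc j)} f"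
      using const[OF j(1)] by (subst continuous_on_cong[OF refl, of _ _ "\<lambda>_. c j"]) auto
    then show "isCont f x" using j by (simp add: continuous_on_eq_continuous_at)
  qed
next
  fix x assume "x \<in> {p 0..<p N}"
  then obtain j where j: "j < N" "p j \<le> x" "x < p (Suc j)"
    using cell_right[of p x N] by auto
  have "\<forall>\<^sub>F t in at_right x. f t = c j"
    using eventually_at_right_real[OF j(3)] by eventually_elim (use j const in auto)
  then show "\<exists>l. (f \<longlongrightarrow> l) (at_right x)" using tendsto_eventually by blast
next
  fix x assume "x \<in> {p 0<..p N}"
  then obtain j where j: "j < N" "p j < x" "x \<le> p (Suc j)"
    using cell_left[of p x N] by auto
  have "\<forall>\<^sub>F t in at_left x. f t = c j"
    using eventually_at_left_real[OF j(2)] by eventually_elim (use j const in auto)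
  then show "\<exists>l. (f \<longlongrightarrow> l) (at_left x)" using tendsto_eventually by blast
qed

text \<open>The breakpoints are the exceptional points in increasing order, together with the two ends.
  No exceptional point lies strictly between two consecutive ones, so there the function is
  continuous on a connected set, and its finite range forces it to be constant.\<close>
lemma finite_range_piecewise_constant:
  fixes f :: "real \<Rightarrow> real"
  assumes "a \<le> b" "finite S" "continuous_on ({a..b} - S) f" "finite C"
    and range: "\<And>x. x \<in> {a..b} - S \<Longrightarrow> f x \<in> C"
  shows "\<exists>(N :: nat) p c. (1 \<le> N \<or> a = b) \<and> p 0 = a \<and> p N = b \<and>
    (\<forall>j<N. p j \<le> p (Suc j)) \<and> (\<forall>j<N. \<forall>x\<in>{p j<..<p (Suc j)}. f x = c j)"
proof -
  define T where "T = S \<inter> {a..b} \<union> {a, b}"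
  define xs where "xs = sorted_list_of_set T"
  define N where "N = length xs - 1"
  have T: "finite T" "T \<noteq> {}" using assms by (auto simp: T_def)
  have set: "set xs = T" using T by (simp add: xs_def)
  then have len: "length xs = Suc N" using T by (cases xs) (auto simp: N_def)
  have sorted: "xs ! i \<le> xs ! j" if "i \<le> j" "j \<le> N" for i j
    using sorted_nth_mono[of xs i j] that len by (simp add: xs_def)
  have inT: "xs ! i \<in> T" if "i \<le> N" for i
    using that len set by (metis less_Suc_eq_le nth_mem)
  have ab: "T \<subseteq> {a..b}" "a \<in> T" "b \<in> T" using \<open>a \<le> b\<close> by (auto simp: T_def)
  have idx: "\<exists>i\<le>N. xs ! i = t" if "t \<in> T" for t
    using that set len by (metis in_set_conv_nth less_Suc_eq_le)
  have first: "xs ! 0 = a"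
  proof (rule order_antisym)
    show "xs ! 0 \<le> a" using idx[OF ab(2)] sorted[of 0] by auto
    show "a \<le> xs ! 0" using inT[of 0] ab(1) by auto
  qed
  have last: "xs ! N = b"
  proof (rule order_antisym)
    show "b \<le> xs ! N" using idx[OF ab(3)] sorted[of _ N] by auto
    show "xs ! N \<le> b" using inT[of N] ab(1) by auto
  qed
  have const: "\<exists>k. \<forall>x\<in>{xs ! j<..<xs ! Suc j}. f x = k" if j: "j < N" for j
  proof -
    let ?I = "{xs ! j<..<xs ! Suc j}"
    have "x \<notin> T" if "x \<in> ?I" for x
    proof
      assume "x \<in> T"
      then obtain i where "i \<le> N" "xs ! i = x" using idx by blast
      then show False
        using that j sorted[of i j] sorted[of "Suc j" i] by (cases "i \<le> j") auto
    qed
    moreover have "?I \<subseteq> {a..b}"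
      using sorted[of 0 j] sorted[of "Suc j" N] first last j by auto
    ultimately have sub: "?I \<subseteq> {a..b} - S" unfolding T_def by blast
    have "f ` ?I \<subseteq> C" using sub range by blast
    then have "f constant_on ?I"
      using continuous_on_subset[OF assms(3) sub] \<open>finite C\<close>
      by (intro continuous_finite_range_constant) (auto intro: finite_subset)
    then show ?thesis by (simp add: constant_on_def)
  qed
  then obtain c where c: "\<forall>j<N. \<forall>x\<in>{xs ! j<..<xs ! Suc j}. f x = c j"
    by metis
  have "1 \<le> N \<or> a = b" using first last by (cases N) auto
  moreover have "\<forall>j<N. xs ! j \<le> xs ! Suc j" using sorted by simp
  ultimately show ?thesis
    using first last c by (intro exI[of _ N] exI[of _ "\<lambda>i. xs ! i"] exI[of _ c]) simp
qed

section \<open>Switching controls\<close>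

lemma switching_pointsD:
  assumes "switching_points r H n \<xi>"
  shows "\<xi> 0 = 0" "\<xi> (2 * n + 1) = r" "(\<Sum>i = 1..n. \<xi> (2 * i) - \<xi> (2 * i - 1)) = H"
    and "\<And>j. j < 2 * n + 1 \<Longrightarrow> \<xi> j \<le> \<xi> (Suc j)"
  using assms unfolding switching_points_def by (blast, blast, blast, metis less_Suc_eq_le Suc_eq_plus1)

lemma switching_control_range: "switching_control n \<xi> x \<in> {0, 1}"
  by (simp add: switching_control_def)

text \<open>On an open cell no other cell interferes: a closed cell of even index to the left ends at or
  before \<open>\<xi> j\<close>, and one to the right starts at or after \<open>\<xi> (Suc j)\<close>.\<close>
lemma switching_control_on_cell:
  assumes mono: "\<And>j. j < 2 * n + 1 \<Longrightarrow> \<xi> j \<le> \<xi> (Suc j)"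
    and j: "j < 2 * n + 1" "\<xi> j < x" "x < \<xi> (Suc j)"
  shows "switching_control n \<xi> x = of_bool (odd j)"
proof (cases "even j")
  case True
  then obtain i where "j = 2 * i" by blast
  then have "\<exists>i\<in>{0..n}. \<xi> (2 * i) \<le> x \<and> x \<le> \<xi> (2 * i + 1)"
    using j by (intro bexI[of _ i]) auto
  then show ?thesis using True by (simp add: switching_control_def)
next
  case False
  then obtain i where i: "j = 2 * i + 1" using oddE by blast
  have "\<not> (\<xi> (2 * k) \<le> x \<and> x \<le> \<xi> (2 * k + 1))" if "k \<in> {0..n}" for k
  proof (cases "k \<le> i")
    case True
    then have "\<xi> (2 * k + 1) \<le> \<xi> j"
      using j(1) i by (intro breakpoints_mono[where p = \<xi>, OF mono]) auto
    then show ?thesis using j by simp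
  next
    case False
    then have "\<xi> (Suc j) \<le> \<xi> (2 * k)"
      using that i by (intro breakpoints_mono[where p = \<xi>, OF mono]) auto
    then show ?thesis using j by simp
  qed
  moreover have "\<exists>i\<in>{0..<n}. \<xi> (2 * i + 1) \<le> x \<and> x \<le> \<xi> (2 * i + 2)"
    using j i by (intro bexI[of _ i]) auto
  ultimately show ?thesis using False by (simp add: switching_control_def)
qed

lemma switching_control_has_integral:
  assumes mono: "\<And>j. j < 2 * n + 1 \<Longrightarrow> \<xi> j \<le> \<xi> (Suc j)"
  shows "(switching_control n \<xi> has_integral (\<Sum>i = 1..n. \<xi> (2 * i) - \<xi> (2 * i - 1)))
    {\<xi> 0..\<xi> (2 * n + 1)}"
proof -
  have "(switching_control n \<xi> has_integral
      (\<Sum>j<2 * n + 1. of_bool (odd j) * (\<xi> (Suc j) - \<xi> j))) {\<xi> 0..\<xi> (2 * n + 1)}"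
    by (rule step_function_has_integral) (rule mono switching_control_on_cell[of n \<xi>, OF mono]; assumption)+
  moreover have "(\<Sum>j<2 * n + 1. of_bool (odd j) * (\<xi> (Suc j) - \<xi> j)) =
    (\<Sum>i = 1..n. \<xi> (2 * i) - \<xi> (2 * i - 1))" for n
    by (induction n) (simp_all del: sum_of_bool_mult_eq sum_mult_of_bool_eq)
  ultimately show ?thesis by (simp only:)
qed

lemma switching_admissible:
  assumes "switching_points r H n \<xi>"
  shows "admissible r H (associated_solution r (switching_control n \<xi>)) (switching_control n \<xi>)"
proof (rule admissible_associated)
  have mono: "\<xi> j \<le> \<xi> (Suc j)" if "j < 2 * n + 1" for j
    by (rule switching_pointsD(4)[OF assms that])
  have ends: "\<xi> 0 = 0" "\<xi> (2 * n + 1) = r" "(\<Sum>i = 1..n. \<xi> (2 * i) - \<xi> (2 * i - 1)) = H"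
    using switching_pointsD[OF assms] by blast+
  show "0 \<le> r" using breakpoints_mono[of "2 * n + 1" \<xi> 0 "2 * n + 1", OF mono] unfolding ends by simp
  show "piecewise_continuous 0 r (switching_control n \<xi>)"
    using step_function_piecewise_continuous[of "2 * n + 1" \<xi> "switching_control n \<xi>"
        "\<lambda>j. of_bool (odd j)", OF switching_control_on_cell[of n \<xi>, OF mono]]
    unfolding ends .
  show "0 \<le> switching_control n \<xi> x" for x by (simp add: switching_control_def)
  show "(switching_control n \<xi> has_integral H) {0..r}"
    using switching_control_has_integral[of n \<xi>, OF mono] unfolding ends .
qed

text \<open>The intervals between breakpoints \<open>p k\<close> of the control need not alternate between the values
  \<open>0\<close> and \<open>1\<close>, but no merging is needed because switching points may coincide: the points
  \<open>\<xi> (2 * k) = p k\<close> are the breakpoints, and the intermediate \<open>\<xi> (2 * k + 1)\<close> is the left end of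
  the \<open>k\<close>-th interval if the control is \<open>1\<close> there and its right end if it is \<open>0\<close>.  The condition
  that the lengths add up to \<open>H\<close> comes for free by comparing integrals.\<close>
lemma zero_one_control_switching:
  assumes adm: "admissible r H y u" and "0 < r"
    and S: "finite S" "\<And>x. x \<in> {0..r} - S \<Longrightarrow> u x \<in> {0, 1}"
  shows "\<exists>n \<xi>. switching_points r H n \<xi> \<and> y = associated_solution r (switching_control n \<xi>)"
proof -
  obtain S' where S': "finite S'" "continuous_on ({0..r} - S') u"
    using adm unfolding admissible_def piecewise_continuous_def by blast
  have cont: "continuous_on ({0..r} - (S \<union> S')) u"
    by (rule continuous_on_subset[OF S'(2)]) auto
  have fin: "finite {0, 1 :: real}" by simp
  have vals: "u x \<in> {0, 1}" if "x \<in> {0..r} - (S \<union> S')" for x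
    using S(2) that by blast
  have "\<exists>(N :: nat) p c. (1 \<le> N \<or> 0 = r) \<and> p 0 = 0 \<and> p N = r \<and>
      (\<forall>j<N. p j \<le> p (Suc j)) \<and> (\<forall>j<N. \<forall>x\<in>{p j<..<p (Suc j)}. u x = c j)"
    by (rule finite_range_piecewise_constant[OF less_imp_le[OF \<open>0 < r\<close>]
          finite_UnI[OF S(1) S'(1)] cont fin]) (rule vals)
  then obtain N p c where steps: "(1 \<le> N \<or> 0 = r) \<and> p 0 = 0 \<and> p N = r \<and>
      (\<forall>j<N. p j \<le> p (Suc j)) \<and> (\<forall>j<N. \<forall>x\<in>{p j<..<p (Suc j)}. u x = c j)"
    by (elim exE) (rule that)
  then have p: "1 \<le> N" "p 0 = 0" "p N = r" "\<And>j. j < N \<Longrightarrow> p j \<le> p (Suc j)"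
      "\<And>j x. j < N \<Longrightarrow> p j < x \<Longrightarrow> x < p (Suc j) \<Longrightarrow> u x = c j"
    using \<open>0 < r\<close> by (blast dest: less_imp_neq, blast, blast, blast, auto)
  \<comment> \<open>The guard on \<open>N\<close> makes the last point \<open>\<xi> (2 * N + 1)\<close> equal to \<open>p N = r\<close>: the final stretch
    of zeros is degenerate.\<close>
  define \<xi> where "\<xi> j = (if odd j \<and> j div 2 < N \<and> c (j div 2) \<noteq> 1
    then p (Suc (j div 2)) else p (j div 2))" for j
  have even_xi: "\<xi> (2 * k) = p k" for k by (simp add: \<xi>_def)
  have odd_xi: "\<xi> (Suc (2 * k)) = (if k < N \<and> c k \<noteq> 1 then p (Suc k) else p k)" for k
    by (simp add: \<xi>_def)
  have mono: "\<xi> j \<le> \<xi> (Suc j)" if "j < 2 * N + 1" for j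
  proof (cases "even j")
    case True
    then obtain k where "j = 2 * k" by blast
    then show ?thesis using p(4)[of k] by (simp add: even_xi odd_xi)
  next
    case False
    then obtain k where k: "j = Suc (2 * k)" by (metis oddE Suc_eq_plus1)
    then have "\<xi> (Suc j) = p (Suc k)" using even_xi[of "Suc k"] by simp
    then show ?thesis using that k p(4)[of k] by (simp add: odd_xi)
  qed
  have agree: "switching_control N \<xi> x = u x"
    if x: "x \<in> {0..r} - (S \<union> p ` {..N})" for x
  proof -
    obtain k where k: "k < N" "p k < x" "x < p (Suc k)"
      using cell_interior[of x p N] x p(2,3) by auto
    have c: "c k = 0 \<or> c k = 1" using p(5)[OF k] S(2)[of x] x by auto
    show ?thesis
    proof (cases "c k = 1")
      case True
      then have "switching_control N \<xi> x = of_bool (odd (Suc (2 * k)))"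
        using k even_xi[of "Suc k"] odd_xi[of k]
        by (intro switching_control_on_cell mono) auto
      then show ?thesis using True p(5)[OF k] by simp
    next
      case False
      then have "switching_control N \<xi> x = of_bool (odd (2 * k))"
        using k even_xi[of k] odd_xi[of k]
        by (intro switching_control_on_cell mono) auto
      then show ?thesis using False c p(5)[OF k] by simp
    qed
  qed
  have fin_exc: "finite (S \<union> p ` {..N})" using S(1) by simp
  have ends: "\<xi> 0 = 0" "\<xi> (2 * N + 1) = r" using p by (simp_all add: \<xi>_def)
  have "(u has_integral H) {0..r}"
    using admissible_has_integral[OF adm, of r] adm \<open>0 < r\<close> by (simp add: admissible_def)
  then have "(switching_control N \<xi> has_integral H) {0..r}"
    by (intro has_integral_spike_finite[of "S \<union> p ` {..N}" _ "switching_control N \<xi>" u]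
        fin_exc agree)
  moreover have "(switching_control N \<xi> has_integral
      (\<Sum>i = 1..N. \<xi> (2 * i) - \<xi> (2 * i - 1))) {0..r}"
    using switching_control_has_integral[of N \<xi>, OF mono] unfolding ends .
  ultimately have "(\<Sum>i = 1..N. \<xi> (2 * i) - \<xi> (2 * i - 1)) = H"
    by (rule has_integral_unique[symmetric])
  then have "switching_points r H N \<xi>"
    unfolding switching_points_def using p(1) ends mono
    by (intro conjI allI impI) (assumption | simp only: less_Suc_eq_le Suc_eq_plus1[symmetric])+
  moreover have "y = associated_solution r (switching_control N \<xi>)"
    using admissible_eq_associated[OF adm]
      associated_solution_cong[where u = u, OF fin_exc agree[symmetric]] by (rule trans)
  ultimately show ?thesis by blast
qed

text \<open>The switching points of the control that is \<open>1\<close> between \<open>t\<close> and \<open>t + H\<close> and \<open>0\<close> elsewhere.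
  Letting \<open>t\<close> vary gives infinitely many minimizers when \<open>H < r\<close>.\<close>
definition single_rise :: "real \<Rightarrow> real \<Rightarrow> real \<Rightarrow> nat \<Rightarrow> real" where
  "single_rise r H t = (\<lambda>j. if j = 0 then 0 else if j = 1 then t else if j = 2 then t + H else r)"

lemma single_rise_switching:
  assumes "0 \<le> t" "0 \<le> H" "t + H \<le> r"
  shows "switching_points r H 1 (single_rise r H t)"
proof -
  have "single_rise r H t i \<le> single_rise r H t (Suc i)" if "i \<le> 2" for i
    using that assms by (auto simp: single_rise_def)
  then show ?thesis by (simp add: switching_points_def single_rise_def)
qed

text \<open>At the later of two starting points, the solution that starts there is still \<open>0\<close>, while
  the one that starts earlier is already positive.\<close>
lemma single_rise_inj:
  assumes "0 < H"
  shows "inj_on (\<lambda>t. associated_solution r (switching_control 1 (single_rise r H t))) {0..r - H}"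
proof (rule linorder_inj_onI)
  fix s t assume st: "s < t" "s \<in> {0..r - H}" "t \<in> {0..r - H}"
  let ?u = "\<lambda>t. switching_control 1 (single_rise r H t)"
  have t: "t \<in> {0..r}" using st assms by auto
  have "?u t x = 0" if "x \<in> {0..t}" for x
    using that by (auto simp: switching_control_def single_rise_def)
  then have "associated_solution r (?u t) t = 0"
    using t integral_cong[of "{0..t}" "?u t" "\<lambda>_. 0"] by (simp add: associated_solution_def)
  moreover have "associated_solution r (?u s) t > 0"
  proof -
    have adm: "admissible r H (associated_solution r (?u s)) (?u s)"
      using st assms by (intro switching_admissible single_rise_switching) auto
    have int: "(?u s has_integral associated_solution r (?u s) t) {0..t}"
      by (rule admissible_has_integral[OF adm t])
    define m where "m = min t (s + H)"
    have "switching_points r H 1 (single_rise r H s)"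
      using st assms by (intro single_rise_switching) auto
    then have mono: "single_rise r H s j \<le> single_rise r H s (Suc j)" if "j < 2 * 1 + 1" for j
      using switching_pointsD(4) that by blast
    have "?u s x = 1" if "s < x" "x < m" for x
    proof -
      have "?u s x = of_bool (odd (1 :: nat))"
        by (rule switching_control_on_cell[where \<xi> = "single_rise r H s", OF mono])
          (use that in \<open>simp_all add: single_rise_def m_def\<close>)
      then show ?thesis by simp
    qed
    then have one: "?u s x = 1" if "x \<in> {s..m} - {s, m}" for x
      using that by simp
    have "s < m" using st assms by (simp add: m_def)
    then have "((\<lambda>_. 1) has_integral (m - s)) {s..m}"
      using has_integral_const_real[of "1::real" s m] by simp
    then have "(?u s has_integral (m - s)) {s..m}"
      by (intro has_integral_spike_finite[of "{s, m}" _ "?u s" "\<lambda>_. 1"] one) simp_all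
    then have "m - s \<le> associated_solution r (?u s) t"
      using int st
      by (intro has_integral_subset_le[of "{s..m}" "{0..t}" "?u s"])
        (auto simp: m_def switching_control_def)
    then show ?thesis using \<open>s < m\<close> by simp
  qed
  ultimately show "associated_solution r (?u s) \<noteq> associated_solution r (?u t)" by force
qed auto

section \<open>The minimizers\<close>

text \<open>The supporting line is the tangent to the density at the mean slope \<open>a = H / r\<close>.  Its linear
  part integrates to zero around the mean, so the lower bound is \<open>r / (1 + a\<^sup>2)\<close>.\<close>
lemma minimizers_steep:
  assumes "0 < r" "r < H"
  shows "newton_solutions r H = {associated_solution r (\<lambda>x. H / r)}"
    and "is_min_resistance r H (r ^ 3 / (r\<^sup>2 + H\<^sup>2))"
proof -
  define a where "a = H / r"
  have a: "1 < a" "a * r = H" using assms by (simp_all add: a_def)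
  define c1 where "c1 = - (2 * a / (1 + a\<^sup>2)\<^sup>2)"
  define c0 where "c0 = 1 / (1 + a\<^sup>2) - c1 * a"
  have a2: "1 < a\<^sup>2" using a by (simp add: one_less_power)
  have excess: "1 / (1 + s\<^sup>2) - (c0 + c1 * s)
    = (s - a)\<^sup>2 * (2 * a * s + a\<^sup>2 - 1) / ((1 + s\<^sup>2) * (1 + a\<^sup>2)\<^sup>2)" for s
    unfolding resistance_tangent_identity[symmetric] c0_def c1_def
    by (simp add: algebra_simps diff_divide_distrib)
  have pos: "2 * a * s + a\<^sup>2 - 1 > 0" "(1 + s\<^sup>2) * (1 + a\<^sup>2)\<^sup>2 > 0" if "s \<ge> 0" for s
  proof -
    have "2 * a * s \<ge> 0" using a that by simp
    then show "2 * a * s + a\<^sup>2 - 1 > 0" using a2 by linarith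
    have "1 + s\<^sup>2 > 0" using zero_le_power2[of s] by linarith
    moreover have "1 + a\<^sup>2 > 0" using a2 by linarith
    ultimately show "(1 + s\<^sup>2) * (1 + a\<^sup>2)\<^sup>2 > 0" by simp
  qed
  have supp: "resistance_support c0 c1"
    unfolding resistance_support_def
  proof (intro allI impI)
    fix s :: real assume "s \<ge> 0"
    then have "1 / (1 + s\<^sup>2) - (c0 + c1 * s) \<ge> 0"
      unfolding excess using pos[of s] by (intro divide_nonneg_pos mult_nonneg_nonneg) auto
    then show "c0 + c1 * s \<le> 1 / (1 + s\<^sup>2)" by simp
  qed
  have touch: "1 / (1 + s\<^sup>2) = c0 + c1 * s \<longleftrightarrow> s \<in> {a}" if "s \<ge> 0" for s
  proof -
    have "1 / (1 + s\<^sup>2) = c0 + c1 * s \<longleftrightarrow> 1 / (1 + s\<^sup>2) - (c0 + c1 * s) = 0" by simp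
    also have "\<dots> \<longleftrightarrow> s = a" unfolding excess using pos[OF that] by auto
    finally show ?thesis by simp
  qed
  have "((\<lambda>x. a) has_integral H) {0..r}"
    using has_integral_const_real[of a 0 r] assms a by (simp add: mult.commute)
  then have wit: "admissible r H (associated_solution r (\<lambda>x. a)) (\<lambda>x. a)"
    using assms a by (intro admissible_associated) (auto simp: piecewise_continuous_def)
  note min = minimizers_from_support[OF _ supp touch wit]
  have "c0 * r + c1 * H = r / (1 + a\<^sup>2)"
    using a(2) by (simp add: c0_def algebra_simps)
  also have "\<dots> = r ^ 3 / (r\<^sup>2 + H\<^sup>2)"
  proof -
    have "r\<^sup>2 + H\<^sup>2 = r\<^sup>2 * (1 + a\<^sup>2)" using a(2) by (auto simp: algebra_simps power_mult_distrib)
    then show ?thesis using assms by (simp add: power3_eq_cube power2_eq_square)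
  qed
  finally show "is_min_resistance r H (r ^ 3 / (r\<^sup>2 + H\<^sup>2))" using min(1) assms by simp
  have "y = associated_solution r (\<lambda>x. a)"
    if "admissible r H y u" "finite S" "\<forall>x\<in>{0..r} - S. u x = a" for y u S
    using admissible_eq_associated[OF that(1)]
      associated_solution_cong[OF that(2), of r u "\<lambda>x. a"] that(3) by simp
  moreover have "newton_solutions r H =
      {y. \<exists>u. admissible r H y u \<and> (\<exists>S. finite S \<and> (\<forall>x\<in>{0..r} - S. u x = a))}"
    using min(2) assms by simp
  ultimately show "newton_solutions r H = {associated_solution r (\<lambda>x. H / r)}"
    using wit unfolding a_def[symmetric] by blast
qed

text \<open>The supporting line is the tangent to the density at \<open>1\<close>, which is also the chord over \<open>[0, 1]\<close>.\<close>
lemma minimizers_flat: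
  assumes "0 < H" "H \<le> r"
  shows "newton_solutions r H =
      {associated_solution r (switching_control n \<xi>) | n \<xi>. switching_points r H n \<xi>}"
    and "is_min_resistance r H (r - H / 2)"
proof -
  have excess: "1 / (1 + s\<^sup>2) - (1 + (- 1 / 2) * s) = s * 2 * (s - 1)\<^sup>2 / (4 * (1 + s\<^sup>2))" for s :: real
  proof -
    have "1 + (- 1 / 2) * s = 1 / (1 + 1\<^sup>2) - 2 * 1 / (1 + 1\<^sup>2)\<^sup>2 * (s - 1)"
      by (simp add: field_simps)
    then show ?thesis
      using resistance_tangent_identity[of s 1] by (simp add: mult.commute)
  qed
  have pos: "4 * (1 + s\<^sup>2) > 0" for s :: real
    using zero_le_power2[of s] unfolding distrib_left by linarith
  have supp: "resistance_support 1 (- 1 / 2)"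
    unfolding resistance_support_def
  proof (intro allI impI)
    fix s :: real assume "s \<ge> 0"
    then have "1 / (1 + s\<^sup>2) - (1 + (- 1 / 2) * s) \<ge> 0"
      unfolding excess using pos[of s] by (intro divide_nonneg_pos mult_nonneg_nonneg) auto
    then show "1 + (- 1 / 2) * s \<le> 1 / (1 + s\<^sup>2)" by simp
  qed
  have touch: "1 / (1 + s\<^sup>2) = 1 + (- 1 / 2) * s \<longleftrightarrow> s \<in> {0, 1}" for s :: real
  proof -
    have "1 / (1 + s\<^sup>2) = 1 + (- 1 / 2) * s \<longleftrightarrow> 1 / (1 + s\<^sup>2) - (1 + (- 1 / 2) * s) = 0" by simp
    also have "\<dots> \<longleftrightarrow> s = 0 \<or> s = 1" unfolding excess using pos[of s] by auto
    finally show ?thesis by simp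
  qed
  have "switching_points r H 1 (single_rise r H 0)"
    using assms by (intro single_rise_switching) auto
  note wit = switching_admissible[OF this]
  note min = minimizers_from_support[OF _ supp touch wit switching_control_range]
  show "is_min_resistance r H (r - H / 2)" using min(1) assms by simp
  have "newton_solutions r H =
      {y. \<exists>u. admissible r H y u \<and> (\<exists>S. finite S \<and> (\<forall>x\<in>{0..r} - S. u x \<in> {0, 1}))}"
    using min(2) assms by simp
  also have "\<dots> = {associated_solution r (switching_control n \<xi>) | n \<xi>. switching_points r H n \<xi>}"
    (is "?L = ?R")
  proof
    show "?L \<subseteq> ?R"
    proof
      fix y assume "y \<in> ?L"
      then obtain u S where u: "admissible r H y u" "finite S" "\<forall>x\<in>{0..r} - S. u x \<in> {0, 1}"
        by blast
      have "0 < r" using assms by simp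
      from zero_one_control_switching[OF u(1) this u(2) bspec[OF u(3)]]
      show "y \<in> ?R" by blast
    qed
    show "?R \<subseteq> ?L"
    proof
      fix y assume "y \<in> ?R"
      then obtain n \<xi> where y: "y = associated_solution r (switching_control n \<xi>)"
        and sw: "switching_points r H n \<xi>" by blast
      have "\<forall>x\<in>{0..r} - {}. switching_control n \<xi> x \<in> {0, 1}"
        using switching_control_range by (rule ballI)
      then show "y \<in> ?L"
        unfolding y using switching_admissible[OF sw] finite.emptyI by blast
    qed
  qed
  finally show "newton_solutions r H = \<dots>" .
qed

theorem theorem8:
  fixes r H :: real
  assumes "r > 0" and "H > 0"
  shows "newton_solutions r H \<noteq> {} \<and>
    (H > r \<longrightarrow>
       newton_solutions r H = {associated_solution r (\<lambda>x. H / r)} \<and>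
       is_min_resistance r H (r ^ 3 / (r\<^sup>2 + H\<^sup>2))) \<and>
    (H \<le> r \<longrightarrow>
       newton_solutions r H =
         {associated_solution r (switching_control n \<xi>) | n \<xi>. switching_points r H n \<xi>} \<and>
       is_min_resistance r H (r - H / 2)) \<and>
    (H < r \<longrightarrow> infinite (newton_solutions r H))"
proof -
  have rise: "associated_solution r (switching_control 1 (single_rise r H t)) \<in> newton_solutions r H"
    if "H \<le> r" "t \<in> {0..r - H}" for t
    using minimizers_flat(1)[OF assms(2) that(1)] single_rise_switching[of t H r] that assms
    by auto
  have "newton_solutions r H \<noteq> {}"
  proof (cases "H \<le> r")
    case True
    then show ?thesis using rise[of 0] by auto
  next
    case False
    then show ?thesis using minimizers_steep(1)[of r H] assms by simp
  qed
  moreover have "infinite (newton_solutions r H)" if "H < r"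
  proof
    assume "finite (newton_solutions r H)"
    then have "finite ((\<lambda>t. associated_solution r (switching_control 1 (single_rise r H t)))
        ` {0..r - H})"
      using rise that by (elim finite_subset[rotated]) auto
    then have "finite {0..r - H}"
      using single_rise_inj[OF assms(2)] by (rule finite_imageD)
    then show False using infinite_Icc[of 0 "r - H"] that by simp
  qed
  ultimately show ?thesis
    using minimizers_steep[of r H] minimizers_flat[of H r] assms by simp
qed

end
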